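(* Let $h:\mathbb{P}_k\to\mathbb{R}$ be nondecreasing in the Löwner order and geodesically convex. Let $r\in\{1,-1\}$ and let $\Phi$ be a positive linear map from $d\times d$ Hermitian matrices to $k\times k$ Hermitian matrices sending $\mathbb{P}_d$ into $\mathbb{P}_k$. Then $\phi(S)=h(\Phi(S^r))$ is geodesically convex on $\mathbb{P}_d$.
   Context: $\mathbb{P}_n$ denotes the $n\times n$ Hermitian positive definite matrices; $\preceq$ is the Löwner order. A linear map $\Phi$ is positive if $\Phi(A)\succeq0$ whenever $A\succeq0$. For $A,B\in\mathbb{P}_n$, $t\in[0,1]$, $A\#_tB:=A^{1/2}(A^{-1/2}BA^{-1/2})^tA^{1/2}$. A function $\phi$ on $\mathbb{P}_n$ is geodesically convex if $\phi(A\#_tB)\le(1-t)\phi(A)+t\phi(B)$ for all $A,B\in\mathbb{P}_n$, $t\in[0,1]$. $h$ nondecreasing means $X\preceq Y\Rightarrow h(X)\le h(Y)$. *)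

theory Defs
  imports "Jordan_Normal_Form.Matrix"
begin

definition adjoint :: "complex mat \<Rightarrow> complex mat" where
  "adjoint A = mat (dim_col A) (dim_row A) (\<lambda>(i,j). cnj (A $$ (j,i)))"

definition hermitian :: "nat \<Rightarrow> complex mat \<Rightarrow> bool" where
  "hermitian n A \<longleftrightarrow> A \<in> carrier_mat n n \<and> adjoint A = A"

definition qform :: "complex mat \<Rightarrow> complex vec \<Rightarrow> complex" where
  "qform A v = (\<Sum>i<dim_vec v. cnj (v $ i) * (A *\<^sub>v v) $ i)"

definition psd :: "nat \<Rightarrow> complex mat \<Rightarrow> bool" where
  "psd n A \<longleftrightarrow> hermitian n A \<and> (\<forall>v \<in> carrier_vec n. Re (qform A v) \<ge> 0)"

definition pd :: "nat \<Rightarrow> complex mat \<Rightarrow> bool" where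
  "pd n A \<longleftrightarrow> hermitian n A \<and> (\<forall>v \<in> carrier_vec n. v \<noteq> 0\<^sub>v n \<longrightarrow> Re (qform A v) > 0)"

definition loewner_le :: "nat \<Rightarrow> complex mat \<Rightarrow> complex mat \<Rightarrow> bool" where
  "loewner_le n X Y \<longleftrightarrow> hermitian n X \<and> hermitian n Y \<and> psd n (Y - X)"

definition unitary :: "nat \<Rightarrow> complex mat \<Rightarrow> bool" where
  "unitary n U \<longleftrightarrow> U \<in> carrier_mat n n \<and> U * adjoint U = 1\<^sub>m n \<and> adjoint U * U = 1\<^sub>m n"

definition rdiag :: "nat \<Rightarrow> (nat \<Rightarrow> real) \<Rightarrow> complex mat" where
  "rdiag n l = mat n n (\<lambda>(i,j). if i = j then complex_of_real (l i) else 0)"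

definition mpow :: "nat \<Rightarrow> complex mat \<Rightarrow> real \<Rightarrow> complex mat" where
  "mpow n A t = (THE X. \<exists>U l. unitary n U \<and> (\<forall>i<n. l i > 0) \<and>
       A = U * rdiag n l * adjoint U \<and> X = U * rdiag n (\<lambda>i. l i powr t) * adjoint U)"

definition gmean :: "nat \<Rightarrow> complex mat \<Rightarrow> complex mat \<Rightarrow> real \<Rightarrow> complex mat" where
  "gmean n A B t = mpow n A (1/2) *
      mpow n (mpow n A (-1/2) * B * mpow n A (-1/2)) t * mpow n A (1/2)"

definition geodesically_convex :: "nat \<Rightarrow> (complex mat \<Rightarrow> real) \<Rightarrow> bool" where
  "geodesically_convex n f \<longleftrightarrow>
     (\<forall>A B t. pd n A \<longrightarrow> pd n B \<longrightarrow> 0 \<le> t \<longrightarrow> t \<le> 1 \<longrightarrow>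
        f (gmean n A B t) \<le> (1 - t) * f A + t * f B)"

definition loewner_mono :: "nat \<Rightarrow> (complex mat \<Rightarrow> real) \<Rightarrow> bool" where
  "loewner_mono n h \<longleftrightarrow> (\<forall>X Y. pd n X \<longrightarrow> pd n Y \<longrightarrow> loewner_le n X Y \<longrightarrow> h X \<le> h Y)"

definition positive_linear_map :: "nat \<Rightarrow> nat \<Rightarrow> (complex mat \<Rightarrow> complex mat) \<Rightarrow> bool" where
  "positive_linear_map d k \<Phi> \<longleftrightarrow>
     (\<forall>A. hermitian d A \<longrightarrow> hermitian k (\<Phi> A)) \<and>
     (\<forall>A B. hermitian d A \<longrightarrow> hermitian d B \<longrightarrow> \<Phi> (A + B) = \<Phi> A + \<Phi> B) \<and>
     (\<forall>c A. hermitian d A \<longrightarrow> \<Phi> (complex_of_real c \<cdot>\<^sub>m A) = complex_of_real c \<cdot>\<^sub>m \<Phi> A) \<and>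
     (\<forall>A. psd d A \<longrightarrow> psd k (\<Phi> A))"

end

theory Submission
  imports Defs "Jordan_Normal_Form.Spectral_Radius" "HOL-Analysis.Equivalence_Lebesgue_Henstock_Integration"
begin

text \<open>
  Positive definite A and B can be written as A = T T* and B = T D T* with T invertible and D
  diagonal, and then the geodesic from A to B is T D^t T*; its inverse is the geodesic between the
  inverses, so the case r = -1 reduces to r = 1. By monotonicity and convexity of h it remains to
  show Ando's inequality: the image of the weighted geometric mean under a positive linear map
  lies below the weighted geometric mean of the images.

  Let R i be the image of T E_ii T*, and let X and Y, the sum of the R i and the sum of the
  l i R i, be the images of A and B. Write X = P P* and Y = P M P*. For s > 0 and a vector v, the
  nonnegativity of the sum of R i [v - (s + l i) u] / (s + l i), evaluated at the minimising u,
  compares the resolvents of the l i with those of M. Integrating against s^(t-1) turns the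
  resolvents into t-th powers.
\<close>

unbundle no vec_syntax
hide_const (open) Linear_Algebra.adjoint
hide_const (open) Finite_Cartesian_Product.mat Finite_Cartesian_Product.vec
hide_type (open) Finite_Cartesian_Product.vec
hide_fact (open) Linear_Algebra.adjoint_def

subsection \<open>Powers as integrals of resolvents\<close>

text \<open>The integrand is positive on the open unit interval, so the integral cannot vanish. It
  is dominated by \<open>s powr (t - 1)\<close> up to 1, integrable at 0 because
  \<open>0 < t\<close>, and by \<open>s powr (t - 2)\<close> beyond 1, integrable at infinity
  because \<open>t < 1\<close>. Together the bounds allow \<open>c\<close>, whose classical value is
  pi / sin (pi t), to be cancelled from an inequality.\<close>

lemma nn_integral_powr_resolvent_bounds:
  fixes t :: real
  assumes t: "0 < t" "t < 1"
  defines "c \<equiv> (\<integral>\<^sup>+ s. ennreal (indicator {0<..} s * (s powr (t - 1) / (s + 1))) \<partial>lborel)"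
  shows "c \<noteq> 0" "c < \<infinity>"
proof -
  show "c \<noteq> 0"
  proof
    assume "c = 0"
    then have "AE s in lborel. ennreal (indicator {0<..} s * (s powr (t - 1) / (s + 1))) = 0"
      unfolding c_def by (subst (asm) nn_integral_0_iff_AE) auto
    then have "AE s in lborel. s \<notin> {0<..<1::real}"
      by eventually_elim (auto simp: ennreal_eq_0_iff indicator_def divide_le_0_iff not_le)
    then have "emeasure lborel {0<..<1::real} = 0"
      by (subst (asm) AE_iff_measurable[where N = "{0<..<1}"]) auto
    then show False by simp
  qed
  have 1: "(\<integral>\<^sup>+ s. ennreal (s powr (t - 1)) * indicator {0..1} s \<partial>lborel) = ennreal (1 / t)"
    using nn_integral_has_integral_lebesgue'[OF _ has_integral_powr_from_0[of "t - 1" 1]] t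
    by simp
  have 2: "(\<integral>\<^sup>+ s. ennreal (s powr (t - 2)) * indicator {1..} s \<partial>lborel) = ennreal (1 / (1 - t))"
    using nn_integral_has_integral_lebesgue'[OF _ has_integral_powr_to_inf[of "t - 2" 1]] t
    by (simp add: divide_simps)
  have "c \<le> (\<integral>\<^sup>+ s. ennreal (s powr (t - 1)) * indicator {0..1} s
      + ennreal (s powr (t - 2)) * indicator {1..} s \<partial>lborel)"
    unfolding c_def
  proof (rule nn_integral_mono)
    fix s :: real
    have "s powr (t - 1) / (s + 1) \<le> s powr (t - 1)" if "0 < s"
      using that by (simp add: divide_simps)
    moreover have "s powr (t - 1) / (s + 1) \<le> s powr (t - 2)" if "1 \<le> s"
    proof -
      have "s powr (t - 1) = s * s powr (t - 2)"
        using that powr_add[of s 1 "t - 2"] by simp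
      then show ?thesis using that by (simp add: divide_simps)
    qed
    ultimately show "ennreal (indicator {0<..} s * (s powr (t - 1) / (s + 1)))
       \<le> ennreal (s powr (t - 1)) * indicator {0..1} s + ennreal (s powr (t - 2)) * indicator {1..} s"
      by (cases "0 < s"; cases "s < 1") (auto intro!: ennreal_leI add_increasing)
  qed
  also have "\<dots> = ennreal (1 / t) + ennreal (1 / (1 - t))"
    by (subst nn_integral_add) (auto simp: 1 2)
  also have "\<dots> < \<infinity>" by simp
  finally show "c < \<infinity>" .
qed

text \<open>Substituting \<open>x * s\<close> for \<open>s\<close> turns
  \<open>x * (x * s) powr (t - 1)\<close> into \<open>x powr t * s powr (t - 1)\<close> and the
  fraction into \<open>1 / (s + 1)\<close>. With nonnegative integrals the identity makes sense even
  when both sides are infinite.\<close>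

lemma nn_integral_powr_resolvent:
  fixes t x :: real
  assumes x: "0 < x"
  shows "(\<integral>\<^sup>+ s. ennreal (indicator {0<..} s * s powr (t - 1) * (x / (s + x))) \<partial>lborel)
    = ennreal (x powr t) * (\<integral>\<^sup>+ s. ennreal (indicator {0<..} s * (s powr (t - 1) / (s + 1))) \<partial>lborel)"
proof -
  have "(\<integral>\<^sup>+ s. ennreal (indicator {0<..} s * s powr (t - 1) * (x / (s + x))) \<partial>lborel)
    = ennreal x * (\<integral>\<^sup>+ s. ennreal (indicator {0<..} (x * s) * (x * s) powr (t - 1) * (x / (x * s + x))) \<partial>lborel)"
    using x by (subst nn_integral_real_affine[where c = x and t = 0]) auto
  also have "\<dots> = (\<integral>\<^sup>+ s. ennreal (x powr t) * ennreal (indicator {0<..} s * (s powr (t - 1) / (s + 1))) \<partial>lborel)"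
  proof (subst nn_integral_cmult[symmetric], simp, rule nn_integral_cong)
    fix s :: real
    have p: "x powr t = x * x powr (t - 1)" using x powr_add[of x 1 "t - 1"] by simp
    have "x * (indicator {0<..} (x * s) * (x * s) powr (t - 1) * (x / (x * s + x)))
        = x powr t * (indicator {0<..} s * (s powr (t - 1) / (s + 1)))"
    proof (cases "0 < s")
      case True
      have "x * s + x = x * (s + 1)" by (simp add: distrib_left)
      then have "x / (x * s + x) = 1 / (s + 1)" using x by simp
      then show ?thesis using True x p by (simp add: powr_mult)
    next
      case False
      then show ?thesis using x by (simp add: zero_less_mult_iff)
    qed
    then show "ennreal x * ennreal (indicator {0<..} (x * s) * (x * s) powr (t - 1) * (x / (x * s + x)))
      = ennreal (x powr t) * ennreal (indicator {0<..} s * (s powr (t - 1) / (s + 1)))"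
      using x by (metis ennreal_mult' less_imp_le powr_ge_zero)
  qed
  also have "\<dots> = ennreal (x powr t) * (\<integral>\<^sup>+ s. ennreal (indicator {0<..} s * (s powr (t - 1) / (s + 1))) \<partial>lborel)"
    by (rule nn_integral_cmult) simp
  finally show ?thesis .
qed

text \<open>The scaling identity is applied to each summand, and the finite sum is exchanged with
  the integral. Nonnegativity of the weights is what lets \<open>ennreal\<close> commute with the
  sums and products.\<close>

lemma sum_powr_eq_nn_integral:
  fixes a b :: "'a \<Rightarrow> real" and t :: real
  assumes K: "finite K" "\<And>i. i \<in> K \<Longrightarrow> 0 \<le> a i" "\<And>i. i \<in> K \<Longrightarrow> 0 < b i"
  shows "ennreal (\<Sum>i\<in>K. a i * b i powr t)
      * (\<integral>\<^sup>+ s. ennreal (indicator {0<..} s * (s powr (t - 1) / (s + 1))) \<partial>lborel)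
    = (\<integral>\<^sup>+ s. ennreal (indicator {0<..} s * s powr (t - 1) * (\<Sum>i\<in>K. a i * (b i / (s + b i)))) \<partial>lborel)"
proof -
  define c where "c = (\<integral>\<^sup>+ s. ennreal (indicator {0<..} s * (s powr (t - 1) / (s + 1))) \<partial>lborel)"
  define w where "w s = indicator {0<..} s * s powr (t - 1)" for s :: real
  have [measurable]: "w \<in> borel_measurable borel" unfolding w_def by measurable
  have "ennreal (\<Sum>i\<in>K. a i * b i powr t) * c = (\<Sum>i\<in>K. ennreal (a i) * (ennreal (b i powr t) * c))"
    using K by (subst sum_ennreal[symmetric]) (auto simp: sum_distrib_right ennreal_mult' mult.assoc)
  also have "\<dots> = (\<Sum>i\<in>K. \<integral>\<^sup>+ s. ennreal (a i) * ennreal (w s * (b i / (s + b i))) \<partial>lborel)"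
  proof (rule sum.cong[OF refl])
    fix i assume i: "i \<in> K"
    have "ennreal (b i powr t) * c = (\<integral>\<^sup>+ s. ennreal (w s * (b i / (s + b i))) \<partial>lborel)"
      unfolding c_def w_def by (rule nn_integral_powr_resolvent[symmetric, OF K(3)[OF i]])
    then show "ennreal (a i) * (ennreal (b i powr t) * c)
        = (\<integral>\<^sup>+ s. ennreal (a i) * ennreal (w s * (b i / (s + b i))) \<partial>lborel)"
      by (simp add: nn_integral_cmult)
  qed
  also have "\<dots> = (\<integral>\<^sup>+ s. (\<Sum>i\<in>K. ennreal (a i) * ennreal (w s * (b i / (s + b i)))) \<partial>lborel)"
    by (rule nn_integral_sum[symmetric]) simp
  also have "\<dots> = (\<integral>\<^sup>+ s. ennreal (w s * (\<Sum>i\<in>K. a i * (b i / (s + b i)))) \<partial>lborel)"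
  proof (rule nn_integral_cong)
    fix s :: real
    have nn: "0 \<le> w s * (b i / (s + b i))" if "i \<in> K" for i
      using K(3)[OF that] by (auto simp: w_def indicator_def)
    have "(\<Sum>i\<in>K. ennreal (a i) * ennreal (w s * (b i / (s + b i))))
        = (\<Sum>i\<in>K. ennreal (a i * (w s * (b i / (s + b i)))))"
      using K(2) nn by (intro sum.cong refl ennreal_mult'[symmetric])
    also have "\<dots> = ennreal (\<Sum>i\<in>K. a i * (w s * (b i / (s + b i))))"
      using K(2) nn by (intro sum_ennreal mult_nonneg_nonneg[OF K(2) nn])
    also have "(\<Sum>i\<in>K. a i * (w s * (b i / (s + b i)))) = w s * (\<Sum>i\<in>K. a i * (b i / (s + b i)))"
      by (simp add: sum_distrib_left mult_ac)
    finally show "(\<Sum>i\<in>K. ennreal (a i) * ennreal (w s * (b i / (s + b i))))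
        = ennreal (w s * (\<Sum>i\<in>K. a i * (b i / (s + b i))))" .
  qed
  finally show ?thesis
    unfolding c_def w_def .
qed

text \<open>Since x powr t is a positive multiple of the integral of s powr (t - 1) * (x / (s + x))
  over s > 0, an inequality for the functions x / (s + x) passes to the powers.\<close>

lemma sum_powr_le_of_resolvent_le:
  fixes p l :: "'a \<Rightarrow> real" and q m :: "'b \<Rightarrow> real"
  assumes fin: "finite I" "finite J" and t: "0 < t" "t < 1"
    and p: "\<And>i. i \<in> I \<Longrightarrow> 0 \<le> p i" and l: "\<And>i. i \<in> I \<Longrightarrow> 0 < l i"
    and q: "\<And>j. j \<in> J \<Longrightarrow> 0 \<le> q j" and m: "\<And>j. j \<in> J \<Longrightarrow> 0 < m j"
    and le: "\<And>s. 0 < s \<Longrightarrow> (\<Sum>i\<in>I. p i * (l i / (s + l i))) \<le> (\<Sum>j\<in>J. q j * (m j / (s + m j)))"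
  shows "(\<Sum>i\<in>I. p i * l i powr t) \<le> (\<Sum>j\<in>J. q j * m j powr t)"
proof -
  define c where "c = (\<integral>\<^sup>+ s. ennreal (indicator {0<..} s * (s powr (t - 1) / (s + 1))) \<partial>lborel)"
  have c: "c \<noteq> 0" "c < \<infinity>"
    using nn_integral_powr_resolvent_bounds[OF t] unfolding c_def by auto
  have "ennreal (\<Sum>i\<in>I. p i * l i powr t) * c \<le> ennreal (\<Sum>j\<in>J. q j * m j powr t) * c"
    unfolding c_def
  proof (subst (1 2) sum_powr_eq_nn_integral, goal_cases)
    case 7
    show ?case
    proof (rule nn_integral_mono, rule ennreal_leI)
      fix s :: real
      show "indicator {0<..} s * s powr (t - 1) * (\<Sum>i\<in>I. p i * (l i / (s + l i)))
          \<le> indicator {0<..} s * s powr (t - 1) * (\<Sum>j\<in>J. q j * (m j / (s + m j)))"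
        using le[of s] by (cases "0 < s") (auto intro!: mult_left_mono)
    qed
  qed (use fin p l q m in auto)
  then have "ennreal (\<Sum>i\<in>I. p i * l i powr t) \<le> ennreal (\<Sum>j\<in>J. q j * m j powr t)"
    using c by (simp add: ennreal_mult_le_mult_iff mult.commute[of _ c])
  then show ?thesis
    using q by (subst (asm) ennreal_le_iff) (auto intro!: sum_nonneg)
qed

subsection \<open>Adjoints, diagonal matrices and sesquilinear forms\<close>

lemma adjoint_carrier: "A \<in> carrier_mat n m \<Longrightarrow> adjoint A \<in> carrier_mat m n"
  by (simp add: adjoint_def carrier_matD)

lemma adjoint_dim [simp]: "dim_row (adjoint A) = dim_col A" "dim_col (adjoint A) = dim_row A"
  by (simp_all add: adjoint_def)

lemma adjoint_index: "i < dim_col A \<Longrightarrow> j < dim_row A \<Longrightarrow> adjoint A $$ (i, j) = cnj (A $$ (j, i))"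
  by (simp add: adjoint_def)

lemma adjoint_adjoint [simp]: "adjoint (adjoint A) = A"
  by (rule eq_matI) (simp_all add: adjoint_def)

lemma adjoint_mult:
  assumes "dim_col A = dim_row B"
  shows "adjoint (A * B) = adjoint B * adjoint A"
  using assms by (intro eq_matI) (auto simp: adjoint_def scalar_prod_def mult.commute)

text \<open>With explicit dimensions in place of carrier premises, all side conditions of these rules
  are ground and can be discharged by rewriting.\<close>

lemma assoc_mult_mat_dim:
  fixes A B C :: "complex mat"
  assumes "dim_col A = dim_row B" "dim_col B = dim_row C"
  shows "(A * B) * C = A * (B * C)"
  using assms by (intro assoc_mult_mat[of _ "dim_row A" "dim_col A" _ "dim_col B" _ "dim_col C"]) auto

lemma one_mult_mat_dim:
  fixes A :: "complex mat"
  shows "dim_row A = n \<Longrightarrow> 1\<^sub>m n * A = A" "dim_col A = n \<Longrightarrow> A * 1\<^sub>m n = A"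
  by (auto intro: left_mult_one_mat[of _ n "dim_col A"] right_mult_one_mat[of _ "dim_row A" n])

text \<open>Once products are nested to the right, an inverse pair occurs as
  \<open>S * (T * X)\<close> and the product \<open>S * T\<close> is no longer a subterm; this rule
  cancels the pair in that position.\<close>

lemma mult_cancel_inverse:
  fixes S T X :: "complex mat"
  assumes "S * T = 1\<^sub>m (dim_row X)" "dim_col S = dim_row T" "dim_col T = dim_row X"
  shows "S * (T * X) = X"
  using assms assoc_mult_mat_dim[of S T X] by (simp add: one_mult_mat_dim)

lemmas mat_dim_simps = adjoint_mult assoc_mult_mat_dim one_mult_mat_dim mult_cancel_inverse

declare assoc_mult_mat [simp del]

lemma adjoint_one [simp]: "adjoint (1\<^sub>m n) = 1\<^sub>m n"
  by (rule eq_matI) (auto simp: adjoint_def)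

lemma rdiag_carrier [simp]: "rdiag n l \<in> carrier_mat n n"
  by (simp add: rdiag_def)

lemma rdiag_dim [simp]: "dim_row (rdiag n l) = n" "dim_col (rdiag n l) = n"
  by (simp_all add: rdiag_def)

lemma adjoint_rdiag [simp]: "adjoint (rdiag n l) = rdiag n l"
  by (rule eq_matI) (auto simp: adjoint_def rdiag_def)

lemma rdiag_cong: "(\<And>i. i < n \<Longrightarrow> l i = m i) \<Longrightarrow> rdiag n l = rdiag n m"
  by (rule eq_matI) (auto simp: rdiag_def)

lemma rdiag_one: "rdiag n (\<lambda>i. 1) = 1\<^sub>m n"
  by (rule eq_matI) (auto simp: rdiag_def)

lemma mult_rdiag_index:
  assumes "A \<in> carrier_mat m n" "i < m" "j < n"
  shows "(A * rdiag n l) $$ (i, j) = A $$ (i, j) * complex_of_real (l j)"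
  using assms by (simp add: scalar_prod_def rdiag_def mult_delta_left mult_delta_right)

lemma rdiag_mult_index:
  assumes "A \<in> carrier_mat n m" "i < n" "j < m"
  shows "(rdiag n l * A) $$ (i, j) = complex_of_real (l i) * A $$ (i, j)"
  using assms by (simp add: scalar_prod_def rdiag_def mult_delta_left mult_delta_right)

lemma rdiag_mult: "rdiag n l * rdiag n m = rdiag n (\<lambda>i. l i * m i)"
  by (rule eq_matI) (auto simp: mult_rdiag_index[of _ n n] simp del: index_mult_mat(1), auto simp: rdiag_def)

lemma rdiag_mult_vec_index:
  assumes "v \<in> carrier_vec n" "i < n"
  shows "(rdiag n l *\<^sub>v v) $ i = complex_of_real (l i) * v $ i"
  using assms by (simp add: scalar_prod_def rdiag_def mult_delta_left mult_delta_right)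

text \<open>Conjugate-linear in the first vector, linear in the second. Values off the diagonal are
  needed because quadratic forms are later expanded at a difference of two vectors.\<close>

definition sform :: "complex mat \<Rightarrow> complex vec \<Rightarrow> complex vec \<Rightarrow> complex" where
  "sform A u v = (\<Sum>i<dim_vec u. cnj (u $ i) * (A *\<^sub>v v) $ i)"

lemma qform_eq_sform: "qform A v = sform A v v"
  by (simp add: qform_def sform_def)

lemma sform_expand:
  assumes "A \<in> carrier_mat n m" "u \<in> carrier_vec n" "v \<in> carrier_vec m"
  shows "sform A u v = (\<Sum>i<n. \<Sum>j<m. cnj (u $ i) * A $$ (i, j) * v $ j)"
  using assms by (auto simp: sform_def scalar_prod_def sum_distrib_left mult.assoc
      lessThan_atLeast0 intro!: sum.cong)

lemma sform_mult_left:
  assumes T: "T \<in> carrier_mat n m" and A: "A \<in> carrier_mat m p"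
    and u: "u \<in> carrier_vec n" and v: "v \<in> carrier_vec p"
  shows "sform (T * A) u v = sform A (adjoint T *\<^sub>v u) v"
proof -
  define w where "w = A *\<^sub>v v"
  have w: "w \<in> carrier_vec m" using A v by (simp add: w_def)
  have Tw: "(T * A) *\<^sub>v v = T *\<^sub>v w" using T A v by (simp add: w_def)
  have "sform (T * A) u v = (\<Sum>i<n. \<Sum>j<m. cnj (u $ i) * T $$ (i, j) * w $ j)"
    using T u w by (auto simp: sform_def Tw scalar_prod_def sum_distrib_left mult.assoc
        lessThan_atLeast0 intro!: sum.cong)
  also have "\<dots> = (\<Sum>j<m. \<Sum>i<n. cnj (u $ i) * T $$ (i, j) * w $ j)"
    by (rule sum.swap)
  also have "\<dots> = sform A (adjoint T *\<^sub>v u) v"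
    using T u w by (auto simp: sform_def w_def[symmetric] scalar_prod_def sum_distrib_left
        adjoint_index lessThan_atLeast0 mult_ac intro!: sum.cong)
  finally show ?thesis .
qed

lemma sform_mult_right:
  assumes "A \<in> carrier_mat n m" "S \<in> carrier_mat m p" "u \<in> carrier_vec n" "v \<in> carrier_vec p"
  shows "sform (A * S) u v = sform A u (S *\<^sub>v v)"
  using assms by (simp add: sform_def)

lemma sform_congruence:
  assumes "T \<in> carrier_mat n m" "A \<in> carrier_mat m m" "u \<in> carrier_vec n" "v \<in> carrier_vec n"
  shows "sform (T * A * adjoint T) u v = sform A (adjoint T *\<^sub>v u) (adjoint T *\<^sub>v v)"
  using sform_mult_right[OF mult_carrier_mat[OF assms(1,2)] adjoint_carrier[OF assms(1)] assms(3,4)]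
    sform_mult_left[OF assms(1,2,3) mult_mat_vec_carrier[OF adjoint_carrier[OF assms(1)] assms(4)]]
  by simp

lemma sform_rdiag:
  assumes "u \<in> carrier_vec n" "v \<in> carrier_vec n"
  shows "sform (rdiag n l) u v = (\<Sum>i<n. complex_of_real (l i) * (cnj (u $ i) * v $ i))"
  using assms by (auto simp: sform_def rdiag_mult_vec_index mult_ac simp del: index_mult_mat_vec intro!: sum.cong)

lemma sform_cnj:
  assumes "A \<in> carrier_mat n n" "u \<in> carrier_vec n" "v \<in> carrier_vec n"
  shows "cnj (sform A u v) = sform (adjoint A) v u"
  unfolding sform_expand[OF assms] sform_expand[OF adjoint_carrier[OF assms(1)] assms(3,2)]
  using assms by (subst sum.swap) (auto simp: adjoint_index mult_ac intro!: sum.cong)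

lemma sform_add_mat:
  assumes "A \<in> carrier_mat n n" "B \<in> carrier_mat n n" "u \<in> carrier_vec n" "v \<in> carrier_vec n"
  shows "sform (A + B) u v = sform A u v + sform B u v"
  using assms by (simp add: sform_expand[of _ n n] sum.distrib distrib_left distrib_right)

lemma sform_minus_mat:
  assumes "A \<in> carrier_mat n n" "B \<in> carrier_mat n n" "u \<in> carrier_vec n" "v \<in> carrier_vec n"
  shows "sform (A - B) u v = sform A u v - sform B u v"
  using assms by (simp add: sform_expand[of _ n n] minus_carrier_mat sum_subtractf left_diff_distrib right_diff_distrib)

lemma sform_smult_mat:
  assumes "A \<in> carrier_mat n n" "u \<in> carrier_vec n" "v \<in> carrier_vec n"
  shows "sform (c \<cdot>\<^sub>m A) u v = c * sform A u v"
  using assms by (simp add: sform_expand[of _ n n] sum_distrib_left mult_ac)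

text \<open>The coefficient is real, so conjugation in the first argument leaves it alone: both
  cross terms carry the same factor \<open>c\<close>, and the last term carries its square.\<close>

lemma sform_diff_smult:
  assumes A: "A \<in> carrier_mat n n" and u: "u \<in> carrier_vec n" and v: "v \<in> carrier_vec n"
  shows "sform A (v - complex_of_real c \<cdot>\<^sub>v u) (v - complex_of_real c \<cdot>\<^sub>v u)
    = sform A v v - complex_of_real c * (sform A u v + sform A v u) + complex_of_real (c\<^sup>2) * sform A u u"
  using assms
  by (simp add: sform_expand[of _ n n] sum_distrib_left sum.distrib sum_subtractf algebra_simps power2_eq_square)

subsection \<open>The spectral theorem\<close>

lemma unitaryD:
  assumes "unitary n U"
  shows "U \<in> carrier_mat n n" "adjoint U \<in> carrier_mat n n" "U * adjoint U = 1\<^sub>m n" "adjoint U * U = 1\<^sub>m n"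
  using assms adjoint_carrier[of U n n] by (auto simp: unitary_def)

lemma unitaryI:
  assumes "U \<in> carrier_mat n n" "adjoint U * U = 1\<^sub>m n"
  shows "unitary n U"
  using assms mat_mult_left_right_inverse[OF adjoint_carrier] by (simp add: unitary_def)

lemma unitary_mult:
  assumes "unitary n U" "unitary n V"
  shows "unitary n (U * V)"
proof (rule unitaryI)
  note U = unitaryD[OF assms(1)] and V = unitaryD[OF assms(2)]
  show "U * V \<in> carrier_mat n n" using U V by simp
  show "adjoint (U * V) * (U * V) = 1\<^sub>m n"
    using U V by (simp add: mat_dim_simps)
qed

lemma hermitian_congruence:
  assumes "T \<in> carrier_mat n m" "hermitian m A"
  shows "hermitian n (T * A * adjoint T)"
proof -
  have A: "A \<in> carrier_mat m m" "adjoint A = A" using assms by (auto simp: hermitian_def)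
  show ?thesis
    using assms(1) A by (auto simp: hermitian_def mat_dim_simps intro!: carrier_matI)
qed

lemma congruence_mult:
  assumes "U \<in> carrier_mat n n" "W \<in> carrier_mat n n" "D \<in> carrier_mat n n"
  shows "(U * W) * D * adjoint (U * W) = U * (W * D * adjoint W) * adjoint U"
  using assms by (simp add: mat_dim_simps)

lemma hermitian_rdiag: "hermitian n (rdiag n l)"
  by (simp add: hermitian_def)

text \<open>Completing \<open>v\<close> to a basis and orthogonalising it keeps \<open>v\<close> in
  first place; dividing each vector by its norm then gives the columns of a unitary matrix. The
  scalar \<open>c\<close> is the reciprocal of the norm of \<open>v\<close>.\<close>

lemma exists_unitary_first_column:
  assumes v: "v \<in> carrier_vec n" and v0: "v \<noteq> 0\<^sub>v n"
  shows "\<exists>U c. unitary n U \<and> col U 0 = c \<cdot>\<^sub>v v"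
proof -
  interpret cof_vec_space n "TYPE(complex)" .
  define b where "b = basis_completion v"
  define ws where "ws = gram_schmidt n b"
  have n: "n \<noteq> 0" using v v0 by (metis carrier_vecD eq_vecI index_zero_vec(2) less_nat_zero_code)
  from basis_completion[OF v v0, folded b_def]
  have dist_b: "distinct b" and indep: "\<not> lin_dep (set b)" and b: "set b \<subseteq> carrier_vec n"
    and hdb: "hd b = v" and len_b: "length b = n" by auto
  from hdb len_b n obtain vs where bv: "b = v # vs" by (cases b) auto
  from gram_schmidt_result[OF b dist_b indep refl, folded ws_def]
  have ws: "set ws \<subseteq> carrier_vec n" "corthogonal ws" "length ws = n" by (auto simp: len_b)
  have hdws: "hd ws = v" using gram_schmidt_hd[OF v, of vs, folded bv] by (simp add: ws_def)
  have w: "ws ! j \<in> carrier_vec n" if "j < n" for j using ws that by auto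
  define q where "q i j = (\<Sum>k<n. cnj (ws ! i $ k) * ws ! j $ k)" for i j
  have q0: "q i j = 0 \<longleftrightarrow> i \<noteq> j" if "i < n" "j < n" for i j
  proof -
    have "q i j = ws ! j \<bullet>c ws ! i"
      using w[OF that(1)] w[OF that(2)]
      by (auto simp: q_def scalar_prod_def lessThan_atLeast0 mult.commute intro!: sum.cong)
    then show ?thesis using corthogonalD[OF ws(2), of j i] that ws(3) by auto
  qed
  \<comment> \<open>These are the squared norms. Gram-Schmidt provides orthogonal vectors that are
    nonzero but not normalised, hence the division by \<open>sqrt (r j)\<close> in
    \<open>U\<close>.\<close>
  define r where "r j = (\<Sum>k<n. (cmod (ws ! j $ k))\<^sup>2)" for j
  have qr: "q j j = complex_of_real (r j)" for j
    unfolding q_def r_def by (simp add: complex_norm_square mult.commute del: of_real_power)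
  have rpos: "0 < r j" if "j < n" for j
  proof -
    have "r j \<noteq> 0" using q0[OF that that] qr[of j] by auto
    moreover have "0 \<le> r j" by (simp add: r_def sum_nonneg)
    ultimately show ?thesis by simp
  qed
  define U where "U = mat n n (\<lambda>(i, j). ws ! j $ i / complex_of_real (sqrt (r j)))"
  have U: "U \<in> carrier_mat n n" by (simp add: U_def)
  have "adjoint U * U = 1\<^sub>m n"
  proof (rule eq_matI)
    fix i j assume "i < dim_row (1\<^sub>m n)" "j < dim_col (1\<^sub>m n)"
    then have ij: "i < n" "j < n" by auto
    have "(adjoint U * U) $$ (i, j)
        = (\<Sum>k<n. cnj (ws ! i $ k) * ws ! j $ k / complex_of_real (sqrt (r i) * sqrt (r j)))"
      using ij by (auto simp: U_def adjoint_def scalar_prod_def lessThan_atLeast0 intro!: sum.cong)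
    also have "\<dots> = q i j / complex_of_real (sqrt (r i) * sqrt (r j))"
      by (simp add: q_def sum_divide_distrib)
    also have "\<dots> = 1\<^sub>m n $$ (i, j)"
      using ij rpos[of j] q0[of i j] by (cases "i = j") (auto simp: qr simp flip: of_real_mult)
    finally show "(adjoint U * U) $$ (i, j) = 1\<^sub>m n $$ (i, j)" .
  qed (use U in auto)
  then have "unitary n U" using U by (rule unitaryI[rotated])
  moreover have "col U 0 = (1 / complex_of_real (sqrt (r 0))) \<cdot>\<^sub>v v"
  proof -
    have "ws ! 0 = v" using hdws ws(3) n by (cases ws) auto
    then show ?thesis using n v by (intro eq_vecI) (auto simp: U_def)
  qed
  ultimately show ?thesis by blast
qed

lemma adjoint_four_block_mat:
  assumes "A \<in> carrier_mat n1 m1" "B \<in> carrier_mat n1 m2" "C \<in> carrier_mat n2 m1" "D \<in> carrier_mat n2 m2"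
  shows "adjoint (four_block_mat A B C D)
    = four_block_mat (adjoint A) (adjoint C) (adjoint B) (adjoint D)"
  using assms by (intro eq_matI) (auto simp: adjoint_def)

text \<open>A complex matrix of positive size has an eigenvector. In a unitary basis that starts
  with a multiple of it, the first column of the matrix is the eigenvalue times the first unit
  vector.\<close>

lemma hermitian_deflation:
  assumes "hermitian n A" "0 < n"
  shows "\<exists>U B e. unitary n U \<and> hermitian n B \<and> A = U * B * adjoint U \<and> col B 0 = e \<cdot>\<^sub>v unit_vec n 0"
proof -
  have A: "A \<in> carrier_mat n n" using assms(1) by (simp add: hermitian_def)
  obtain e v where v: "v \<in> carrier_vec n" "v \<noteq> 0\<^sub>v n" and ev: "A *\<^sub>v v = e \<cdot>\<^sub>v v"
    using spectrum_non_empty[OF A assms(2)] A by (auto simp: spectrum_def eigenvalue_def eigenvector_def)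
  obtain U c where "unitary n U" and Uv: "col U 0 = c \<cdot>\<^sub>v v"
    using exists_unitary_first_column[OF v] by (elim exE conjE)
  note U = unitaryD[OF this(1)]
  define B where "B = adjoint U * A * U"
  have B: "B \<in> carrier_mat n n" unfolding B_def using U(1,2) A by (intro mult_carrier_mat)
  have hB: "adjoint B = B"
    using hermitian_congruence[OF U(2) assms(1)] unfolding B_def hermitian_def adjoint_adjoint by blast
  have ABU: "A = U * B * adjoint U"
    using congruence_mult[OF U(1,2) A] A unfolding B_def U(3) adjoint_adjoint adjoint_one
    by (simp add: one_mult_mat_dim)
  have col0: "col B 0 = e \<cdot>\<^sub>v unit_vec n 0"
  proof -
    have "col B 0 = (adjoint U * A) *\<^sub>v col U 0"
      unfolding B_def by (rule col_mult2[OF mult_carrier_mat[OF U(2) A] U(1) assms(2)])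
    also have "\<dots> = adjoint U *\<^sub>v (A *\<^sub>v col U 0)"
      using U(1) by (intro assoc_mult_mat_vec[OF U(2) A]) auto
    also have "A *\<^sub>v col U 0 = e \<cdot>\<^sub>v col U 0"
      using A v by (simp add: Uv ev mult_mat_vec smult_smult_assoc mult.commute)
    also have "adjoint U *\<^sub>v (e \<cdot>\<^sub>v col U 0) = e \<cdot>\<^sub>v (adjoint U *\<^sub>v col U 0)"
      using U(1) by (intro mult_mat_vec[OF U(2)]) auto
    also have "adjoint U *\<^sub>v col U 0 = col (adjoint U * U) 0"
      by (rule col_mult2[symmetric, OF U(2,1) assms(2)])
    finally show ?thesis using assms(2) by (simp add: U(4))
  qed
  show ?thesis using \<open>unitary n U\<close> B hB ABU col0 unfolding hermitian_def by blast
qed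

text \<open>Induction on the dimension. After deflation, symmetry clears the first row as well, and
  the remaining block \<open>C\<close> is Hermitian of one size less. Its diagonalisation is
  extended by a 1 in the corner and composed with the deflating unitary matrix.\<close>

theorem hermitian_spectral:
  assumes "hermitian n A"
  shows "\<exists>U l. unitary n U \<and> A = U * rdiag n l * adjoint U"
  using assms
proof (induction n arbitrary: A)
  case 0
  then have "A = 1\<^sub>m 0 * rdiag 0 (\<lambda>_. 0) * adjoint (1\<^sub>m 0)"
    by (intro eq_matI) (auto simp: hermitian_def)
  moreover have "unitary 0 (1\<^sub>m 0)" by (rule unitaryI) auto
  ultimately show ?case by blast
next
  case (Suc m)
  let ?n = "Suc m"
  obtain U B e where "unitary ?n U" and hermB: "hermitian ?n B" and ABU: "A = U * B * adjoint U"
    and col0: "col B 0 = e \<cdot>\<^sub>v unit_vec ?n 0"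
    using hermitian_deflation[OF Suc.prems] by blast
  note U = unitaryD[OF this(1)]
  have B: "B \<in> carrier_mat ?n ?n" and hB: "adjoint B = B" using hermB by (auto simp: hermitian_def)
  have Bi0: "B $$ (i, 0) = (if i = 0 then e else 0)" if "i < ?n" for i
    using arg_cong[OF col0, of "\<lambda>x. x $ i"] that B by (auto simp: unit_vec_def)
  have Bcnj: "B $$ (i, j) = cnj (B $$ (j, i))" if "i < ?n" "j < ?n" for i j
    using arg_cong[OF hB, of "\<lambda>X. X $$ (i, j)"] that B by (simp add: adjoint_index)
  \<comment> \<open>The eigenvalue is a diagonal entry of a Hermitian matrix and therefore real, as
    \<open>rdiag\<close> requires.\<close>
  have e: "complex_of_real (Re e) = e"
    using Bcnj[of 0 0] Bi0[of 0] by (simp add: complex_eq_iff)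
  define C where "C = mat m m (\<lambda>(i, j). B $$ (Suc i, Suc j))"
  have C: "C \<in> carrier_mat m m" by (simp add: C_def)
  have "adjoint C = C"
  proof (rule eq_matI)
    fix i j assume "i < dim_row C" "j < dim_col C"
    then show "adjoint C $$ (i, j) = C $$ (i, j)"
      using Bcnj[of "Suc i" "Suc j"] by (simp add: C_def adjoint_index)
  qed (simp_all add: C_def)
  then have "hermitian m C" using C by (simp add: hermitian_def)
  from Suc.IH[OF this] obtain V l where "unitary m V" and CV: "C = V * rdiag m l * adjoint V" by blast
  note V = unitaryD[OF this(1)]
  \<comment> \<open>\<open>W\<close> fixes the first coordinate and acts as \<open>V\<close> on the
    others; correspondingly \<open>L\<close> puts the deflated eigenvalue in front of
    \<open>l\<close>, shifted by one.\<close>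
  define W where "W = four_block_mat (1\<^sub>m 1) (0\<^sub>m 1 m) (0\<^sub>m m 1) V"
  define L where "L = case_nat (Re e) l"
  have W: "W \<in> carrier_mat ?n ?n" unfolding W_def using V(1) by (intro carrier_matI) simp_all
  have zadj: "adjoint (0\<^sub>m i j) = 0\<^sub>m j i" for i j by (rule eq_matI) (auto simp: adjoint_def)
  have aW: "adjoint W = four_block_mat (1\<^sub>m 1) (0\<^sub>m 1 m) (0\<^sub>m m 1) (adjoint V)"
    unfolding W_def by (simp add: adjoint_four_block_mat[OF one_carrier_mat zero_carrier_mat zero_carrier_mat V(1)] zadj)
  have "adjoint W * W = 1\<^sub>m ?n"
    unfolding aW unfolding W_def
      mult_four_block_mat[OF one_carrier_mat zero_carrier_mat zero_carrier_mat V(2)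
        one_carrier_mat zero_carrier_mat zero_carrier_mat V(1)]
    using V(1,2) by (simp add: V(4))
  then have uW: "unitary ?n W" using W by (intro unitaryI)
  have dL: "rdiag ?n L = four_block_mat (rdiag 1 (\<lambda>_. Re e)) (0\<^sub>m 1 m) (0\<^sub>m m 1) (rdiag m l)"
    by (rule eq_matI) (auto simp: rdiag_def L_def split: nat.split)
  have B4: "B = four_block_mat (rdiag 1 (\<lambda>_. Re e)) (0\<^sub>m 1 m) (0\<^sub>m m 1) C"
  proof (rule eq_matI)
    fix i j assume "i < dim_row (four_block_mat (rdiag 1 (\<lambda>_. Re e)) (0\<^sub>m 1 m) (0\<^sub>m m 1) C)"
      "j < dim_col (four_block_mat (rdiag 1 (\<lambda>_. Re e)) (0\<^sub>m 1 m) (0\<^sub>m m 1) C)"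
    then have ij: "i < ?n" "j < ?n" using C by auto
    show "B $$ (i, j) = four_block_mat (rdiag 1 (\<lambda>_. Re e)) (0\<^sub>m 1 m) (0\<^sub>m m 1) C $$ (i, j)"
      using ij C e Bi0[of i] Bi0[of j] Bcnj[of 0 j]
      by (cases i; cases j) (auto simp: C_def rdiag_def)
  qed (use B C in auto)
  have "W * rdiag ?n L * adjoint W = B"
    unfolding aW dL B4 CV unfolding W_def
      mult_four_block_mat[OF one_carrier_mat zero_carrier_mat zero_carrier_mat V(1)
        rdiag_carrier zero_carrier_mat zero_carrier_mat rdiag_carrier]
    using V(1,2)
    by (subst mult_four_block_mat[of _ 1 1 _ m _ m _ _ 1 _ m])
      (simp_all add: left_add_zero_mat[OF C, unfolded CV])
  then have "A = (U * W) * rdiag ?n L * adjoint (U * W)"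
    using congruence_mult[OF U(1) W rdiag_carrier] ABU by simp
  then show ?case using unitary_mult[OF \<open>unitary ?n U\<close> uW] by blast
qed

subsection \<open>Powers and geometric means of positive definite matrices\<close>

text \<open>The definite description in \<open>mpow\<close> requires that all diagonalisations of
  one matrix yield the same power. For two of them, \<open>W = adjoint V * U\<close> intertwines the
  diagonal matrices of \<open>l\<close> and \<open>m\<close>; so each entry of \<open>W\<close> is
  zero or has \<open>l j = m i\<close>, and \<open>W\<close> intertwines their powers too.\<close>

lemma mpow_spectral:
  assumes "unitary n U" and l: "\<forall>i<n. 0 < l i"
  shows "mpow n (U * rdiag n l * adjoint U) t = U * rdiag n (\<lambda>i. l i powr t) * adjoint U"
  unfolding mpow_def
proof (rule the_equality)
  show "\<exists>V m. unitary n V \<and> (\<forall>i<n. 0 < m i) \<and> U * rdiag n l * adjoint U = V * rdiag n m * adjoint V \<and>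
      U * rdiag n (\<lambda>i. l i powr t) * adjoint U = V * rdiag n (\<lambda>i. m i powr t) * adjoint V"
    using assms by blast
next
  fix X
  assume "\<exists>V m. unitary n V \<and> (\<forall>i<n. 0 < m i) \<and> U * rdiag n l * adjoint U = V * rdiag n m * adjoint V \<and>
      X = V * rdiag n (\<lambda>i. m i powr t) * adjoint V"
  then obtain V m where "unitary n V" and m: "\<forall>i<n. 0 < m i"
    and eq: "U * rdiag n l * adjoint U = V * rdiag n m * adjoint V"
    and X: "X = V * rdiag n (\<lambda>i. m i powr t) * adjoint V" by blast
  note U = unitaryD[OF assms(1)] and V = unitaryD[OF \<open>unitary n V\<close>]
  define W where "W = adjoint V * U"
  have W: "W \<in> carrier_mat n n" using U V by (simp add: W_def)
  have "W * rdiag n l = adjoint V * (U * rdiag n l * adjoint U) * U"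
    using U V by (simp add: W_def mat_dim_simps)
  also have "\<dots> = rdiag n m * W"
    unfolding eq using U V by (simp add: W_def mat_dim_simps)
  finally have WD: "W * rdiag n l = rdiag n m * W" .
  have "W * rdiag n (\<lambda>i. l i powr t) = rdiag n (\<lambda>i. m i powr t) * W"
  proof (rule eq_matI)
    fix i j assume "i < dim_row (rdiag n (\<lambda>i. m i powr t) * W)" "j < dim_col (rdiag n (\<lambda>i. m i powr t) * W)"
    then have ij: "i < n" "j < n" using W by auto
    have "W $$ (i, j) * complex_of_real (l j) = complex_of_real (m i) * W $$ (i, j)"
      using arg_cong[OF WD, of "\<lambda>Z. Z $$ (i, j)"]
      by (simp only: mult_rdiag_index[OF W ij] rdiag_mult_index[OF W ij])
    then have "W $$ (i, j) = 0 \<or> l j = m i" by auto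
    then show "(W * rdiag n (\<lambda>i. l i powr t)) $$ (i, j) = (rdiag n (\<lambda>i. m i powr t) * W) $$ (i, j)"
      unfolding mult_rdiag_index[OF W ij] rdiag_mult_index[OF W ij] by auto
  qed (use W in auto)
  then have "V * (W * rdiag n (\<lambda>i. l i powr t)) * adjoint U = V * (rdiag n (\<lambda>i. m i powr t) * W) * adjoint U"
    by simp
  then show "X = U * rdiag n (\<lambda>i. l i powr t) * adjoint U"
    unfolding X using U V by (simp add: W_def mat_dim_simps)
qed

lemma pd_carrier: "pd n A \<Longrightarrow> A \<in> carrier_mat n n"
  by (simp add: pd_def hermitian_def)

text \<open>From \<open>T * S = 1\<^sub>m n\<close> it follows that \<open>adjoint S\<close> is a
  left inverse of \<open>adjoint T\<close>. Hence \<open>adjoint T\<close> sends no nonzero vector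
  to zero, and positivity at the image vector carries over.\<close>

lemma pd_congruence:
  assumes T: "T \<in> carrier_mat n n" and S: "S \<in> carrier_mat n n" and TS: "T * S = 1\<^sub>m n" and A: "pd n A"
  shows "pd n (T * A * adjoint T)"
  unfolding pd_def
proof (intro conjI ballI impI)
  show "hermitian n (T * A * adjoint T)"
    using hermitian_congruence[OF T] A by (simp add: pd_def)
  fix v :: "complex vec" assume v: "v \<in> carrier_vec n" "v \<noteq> 0\<^sub>v n"
  have ST: "adjoint S * adjoint T = 1\<^sub>m n"
    using T S adjoint_mult[of T S] by (simp add: TS)
  have w: "adjoint T *\<^sub>v v \<in> carrier_vec n" using adjoint_carrier[OF T] v(1) by (rule mult_mat_vec_carrier)
  have "adjoint T *\<^sub>v v \<noteq> 0\<^sub>v n"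
  proof
    assume "adjoint T *\<^sub>v v = 0\<^sub>v n"
    then have "adjoint S *\<^sub>v (adjoint T *\<^sub>v v) = 0\<^sub>v n"
      using S by (intro eq_vecI) (auto simp: scalar_prod_def)
    moreover have "adjoint S *\<^sub>v (adjoint T *\<^sub>v v) = (adjoint S * adjoint T) *\<^sub>v v"
      by (rule assoc_mult_mat_vec[symmetric, OF adjoint_carrier[OF S] adjoint_carrier[OF T] v(1)])
    ultimately show False using v by (simp add: ST)
  qed
  then have "0 < Re (sform A (adjoint T *\<^sub>v v) (adjoint T *\<^sub>v v))"
    using A w by (simp add: pd_def qform_eq_sform)
  then show "0 < Re (qform (T * A * adjoint T) v)"
    using sform_congruence[OF T pd_carrier[OF A] v(1) v(1)] by (simp add: qform_eq_sform)
qed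

lemma Re_sform_rdiag:
  assumes "v \<in> carrier_vec n"
  shows "Re (sform (rdiag n l) v v) = (\<Sum>i<n. l i * (cmod (v $ i))\<^sup>2)"
  unfolding sform_rdiag[OF assms assms] cmod_power2 by (simp add: power2_eq_square)

lemma pd_rdiag:
  assumes "\<forall>i<n. 0 < l i"
  shows "pd n (rdiag n l)"
  unfolding pd_def
proof (intro conjI ballI impI hermitian_rdiag)
  fix v :: "complex vec" assume v: "v \<in> carrier_vec n" "v \<noteq> 0\<^sub>v n"
  have q: "Re (qform (rdiag n l) v) = (\<Sum>i<n. l i * (cmod (v $ i))\<^sup>2)"
    using v(1) by (simp add: qform_eq_sform Re_sform_rdiag)
  from v obtain j where j: "j < n" "v $ j \<noteq> 0"
    by (metis carrier_vecD eq_vecI index_zero_vec)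
  show "0 < Re (qform (rdiag n l) v)"
    unfolding q using j assms by (intro sum_pos2[of _ j]) (auto intro: less_imp_le)
qed

text \<open>Undoing the unitary congruence shows that the diagonal matrix of eigenvalues is itself
  positive definite; its form at the unit vector \<open>i\<close> is \<open>l i\<close>.\<close>

lemma pd_spectral:
  assumes "pd n A"
  obtains U l where "unitary n U" "\<forall>i<n. 0 < l i" "A = U * rdiag n l * adjoint U"
proof -
  from hermitian_spectral[of n A] assms obtain U l
    where "unitary n U" and A: "A = U * rdiag n l * adjoint U" by (auto simp: pd_def)
  note U = unitaryD[OF \<open>unitary n U\<close>]
  have "pd n (adjoint U * A * adjoint (adjoint U))"
    by (rule pd_congruence[OF U(2,1,4) assms])
  also have "adjoint U * A * adjoint (adjoint U) = rdiag n l"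
    unfolding A using U by (simp add: mat_dim_simps)
  finally have D: "pd n (rdiag n l)" .
  have "0 < l i" if i: "i < n" for i
  proof -
    have "unit_vec n i \<noteq> (0\<^sub>v n :: complex vec)"
      using arg_cong[of "unit_vec n i" "0\<^sub>v n :: complex vec" "\<lambda>v. v $ i"] i by auto
    then have "0 < Re (sform (rdiag n l) (unit_vec n i) (unit_vec n i))"
      using D by (simp add: pd_def qform_eq_sform)
    also have "\<dots> = (\<Sum>j<n. if j = i then l j else 0)"
      unfolding Re_sform_rdiag[OF unit_vec_carrier] using i by (intro sum.cong) (auto simp: unit_vec_def)
    finally show ?thesis using i by simp
  qed
  then show thesis using that \<open>unitary n U\<close> A by blast
qed

lemma mpow_one:
  assumes "pd n A"
  shows "mpow n A 1 = A"
proof -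
  obtain U l where U: "unitary n U" "\<forall>i<n. 0 < l i" "A = U * rdiag n l * adjoint U"
    using pd_spectral[OF assms] .
  have "rdiag n (\<lambda>i. l i powr 1) = rdiag n l" using U(2) by (intro rdiag_cong) auto
  then show ?thesis using mpow_spectral[OF U(1,2), of 1] U(3) by simp
qed

text \<open>The spectral expression \<open>?Y\<close> is a right inverse of \<open>A\<close> and
  \<open>X\<close> is a left inverse, so evaluating \<open>X * (A * ?Y)\<close> in two ways
  identifies them.\<close>

lemma mpow_minus_one:
  assumes A: "pd n A" and X: "X \<in> carrier_mat n n" "X * A = 1\<^sub>m n"
  shows "mpow n A (-1) = X"
proof -
  obtain U l where u: "unitary n U" and l: "\<forall>i<n. 0 < l i" and AU: "A = U * rdiag n l * adjoint U"
    using pd_spectral[OF A] .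
  note U = unitaryD[OF u]
  let ?Y = "U * rdiag n (\<lambda>i. l i powr -1) * adjoint U"
  have "rdiag n l * rdiag n (\<lambda>i. l i powr -1) = rdiag n (\<lambda>i. 1)"
    unfolding rdiag_mult using l by (intro rdiag_cong) (auto simp: powr_minus)
  then have D: "rdiag n l * rdiag n (\<lambda>i. l i powr -1) = 1\<^sub>m n" by (simp add: rdiag_one)
  have "A * ?Y = 1\<^sub>m n"
    unfolding AU using U D by (simp add: mat_dim_simps)
  then have "X * (A * ?Y) = X" using X by (simp add: one_mult_mat_dim)
  moreover have "X * (A * ?Y) = ?Y"
    using X U pd_carrier[OF A] by (intro mult_cancel_inverse) auto
  ultimately show ?thesis using mpow_spectral[OF u l, of "-1"] AU by simp
qed

text \<open>The inverse is again written as a congruence of a diagonal matrix, now by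
  \<open>adjoint S\<close>, and the double adjoint is kept for that shape. This is how inverses of
  points on a geodesic become points on another geodesic.\<close>

lemma mpow_minus_one_congruence:
  assumes T: "T \<in> carrier_mat n n" "S \<in> carrier_mat n n" "T * S = 1\<^sub>m n" and l: "\<forall>i<n. 0 < l i"
  shows "mpow n (T * rdiag n l * adjoint T) (-1) = adjoint S * rdiag n (\<lambda>i. 1 / l i) * adjoint (adjoint S)"
proof (rule mpow_minus_one)
  show "pd n (T * rdiag n l * adjoint T)"
    using pd_congruence[OF T pd_rdiag[OF l]] .
  show "adjoint S * rdiag n (\<lambda>i. 1 / l i) * adjoint (adjoint S) \<in> carrier_mat n n"
    using T by (intro carrier_matI) auto
  have ST: "S * T = 1\<^sub>m n" by (rule mat_mult_left_right_inverse[OF T])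
  have aST: "adjoint S * adjoint T = 1\<^sub>m n" using T adjoint_mult[of T S] by simp
  have "rdiag n (\<lambda>i. 1 / l i) * rdiag n l = rdiag n (\<lambda>i. 1)"
    unfolding rdiag_mult using l by (intro rdiag_cong) auto
  then have D: "rdiag n (\<lambda>i. 1 / l i) * rdiag n l = 1\<^sub>m n" by (simp add: rdiag_one)
  show "adjoint S * rdiag n (\<lambda>i. 1 / l i) * adjoint (adjoint S) * (T * rdiag n l * adjoint T) = 1\<^sub>m n"
    using T ST aST D by (simp add: mat_dim_simps)
qed

text \<open>With \<open>P\<close> and \<open>Q\<close> the powers 1/2 and -1/2 of \<open>A\<close>,
  diagonalise \<open>M = Q * B * Q\<close> by a unitary \<open>V\<close> and put
  \<open>T = P * V\<close>, with inverse \<open>S = adjoint V * Q\<close>. Since \<open>T\<close>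
  does not depend on \<open>t\<close>, the whole geodesic is one congruence of powers of a diagonal
  matrix. The identity inside \<open>A\<close> is written with \<open>rdiag\<close> so that both
  endpoints have the same shape.\<close>

lemma gmean_simultaneous_diagonalization:
  assumes A: "pd n A" and B: "pd n B"
  obtains T S l where "T \<in> carrier_mat n n" "S \<in> carrier_mat n n" "T * S = 1\<^sub>m n" "\<forall>i<n. 0 < l i"
    "A = T * rdiag n (\<lambda>_. 1) * adjoint T" "B = T * rdiag n l * adjoint T"
    "\<And>t. gmean n A B t = T * rdiag n (\<lambda>i. l i powr t) * adjoint T"
proof -
  obtain U a where u: "unitary n U" and a: "\<forall>i<n. 0 < a i" and AU: "A = U * rdiag n a * adjoint U"
    using pd_spectral[OF A] .
  note U = unitaryD[OF u]
  define P where "P = U * rdiag n (\<lambda>i. a i powr (1/2)) * adjoint U"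
  define Q where "Q = U * rdiag n (\<lambda>i. a i powr (-1/2)) * adjoint U"
  have P: "mpow n A (1/2) = P" unfolding AU P_def by (rule mpow_spectral[OF u a])
  have Q: "mpow n A (-1/2) = Q" unfolding AU Q_def by (rule mpow_spectral[OF u a])
  have carr: "P \<in> carrier_mat n n" "Q \<in> carrier_mat n n"
    using U by (auto simp: P_def Q_def intro!: carrier_matI)
  have adj: "adjoint P = P" "adjoint Q = Q"
    using U by (simp_all add: P_def Q_def mat_dim_simps)
  have "rdiag n (\<lambda>i. a i powr (1/2)) * rdiag n (\<lambda>i. a i powr (-1/2)) = rdiag n (\<lambda>_. 1)"
    unfolding rdiag_mult using a by (intro rdiag_cong) (auto simp flip: powr_add)
  then have "rdiag n (\<lambda>i. a i powr (1/2)) * rdiag n (\<lambda>i. a i powr (-1/2)) = 1\<^sub>m n" by (simp add: rdiag_one)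
  then have PQ: "P * Q = 1\<^sub>m n"
    using U by (simp add: P_def Q_def mat_dim_simps)
  have QP: "Q * P = 1\<^sub>m n" by (rule mat_mult_left_right_inverse[OF carr PQ])
  have "rdiag n (\<lambda>i. a i powr (1/2)) * rdiag n (\<lambda>i. a i powr (1/2)) = rdiag n a"
    unfolding rdiag_mult using a by (intro rdiag_cong) (auto simp flip: powr_add)
  then have PP: "P * P = A"
    using U AU by (simp add: P_def mat_dim_simps flip: assoc_mult_mat_dim[of "rdiag n _" "rdiag n _"])
  define M where "M = Q * B * Q"
  have "pd n M"
    using pd_congruence[OF carr(2,1) QP B] by (simp add: M_def adj)
  then obtain V l where v: "unitary n V" and l: "\<forall>i<n. 0 < l i" and MV: "M = V * rdiag n l * adjoint V"
    using pd_spectral by blast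
  note V = unitaryD[OF v] and Bc = pd_carrier[OF B]
  define T where "T = P * V"
  define S where "S = adjoint V * Q"
  show thesis
  proof (rule that[of T S l, OF _ _ _ l])
    show "T \<in> carrier_mat n n" "S \<in> carrier_mat n n"
      using carr V by (auto simp: T_def S_def intro!: carrier_matI)
    show "T * S = 1\<^sub>m n" using carr V PQ by (simp add: T_def S_def mat_dim_simps)
    show "A = T * rdiag n (\<lambda>_. 1) * adjoint T"
      using carr V PP by (simp add: T_def mat_dim_simps adj rdiag_one)
    have PMP: "T * D * adjoint T = P * (V * D * adjoint V) * P" if "D \<in> carrier_mat n n" for D
      using congruence_mult[OF carr(1) V(1) that] by (simp add: T_def adj)
    show "B = T * rdiag n l * adjoint T"
      unfolding PMP[OF rdiag_carrier] MV[symmetric] M_def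
      using carr PQ QP Bc by (simp add: mat_dim_simps)
    show "gmean n A B t = T * rdiag n (\<lambda>i. l i powr t) * adjoint T" for t
      unfolding gmean_def P Q M_def[symmetric] PMP[OF rdiag_carrier]
      unfolding MV by (simp add: mpow_spectral[OF v l])
  qed
qed

subsection \<open>Ando's inequality\<close>

lemma psd_congruence_rdiag:
  assumes T: "T \<in> carrier_mat n n" and l: "\<And>i. i < n \<Longrightarrow> 0 \<le> l i"
  shows "psd n (T * rdiag n l * adjoint T)"
  unfolding psd_def
proof (intro conjI ballI hermitian_congruence[OF T hermitian_rdiag])
  fix v :: "complex vec" assume v: "v \<in> carrier_vec n"
  have w: "adjoint T *\<^sub>v v \<in> carrier_vec n" by (rule mult_mat_vec_carrier[OF adjoint_carrier[OF T] v])
  show "0 \<le> Re (qform (T * rdiag n l * adjoint T) v)"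
    unfolding qform_eq_sform sform_congruence[OF T rdiag_carrier v v] Re_sform_rdiag[OF w]
    using l by (intro sum_nonneg mult_nonneg_nonneg) auto
qed

text \<open>Linearity of \<Phi> is available on Hermitian matrices, and every congruence of a real
  diagonal matrix is one. Stating the decomposition through forms avoids sums of matrices.\<close>

lemma positive_linear_map_sform:
  assumes \<Phi>: "positive_linear_map d k \<Phi>" and T: "T \<in> carrier_mat d d"
    and u: "u \<in> carrier_vec k" and v: "v \<in> carrier_vec k"
  shows "sform (\<Phi> (T * rdiag d l * adjoint T)) u v
    = (\<Sum>i<d. complex_of_real (l i) *
        sform (\<Phi> (T * rdiag d (\<lambda>j. if j = i then 1 else 0) * adjoint T)) u v)"
proof -
  define G where "G f = T * rdiag d f * adjoint T" for f
  have hG: "hermitian d (G f)" for f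
    unfolding G_def by (rule hermitian_congruence[OF T hermitian_rdiag])
  have hP: "\<Phi> (G f) \<in> carrier_mat k k" for f
    using \<Phi> hG[of f] by (auto simp: positive_linear_map_def hermitian_def)
  have smult: "\<Phi> (G (\<lambda>j. c * f j)) = complex_of_real c \<cdot>\<^sub>m \<Phi> (G f)" for c f
  proof -
    have "rdiag d (\<lambda>j. c * f j) = complex_of_real c \<cdot>\<^sub>m rdiag d f"
      by (rule eq_matI) (auto simp: rdiag_def)
    then have "G (\<lambda>j. c * f j) = complex_of_real c \<cdot>\<^sub>m G f"
      unfolding G_def
      by (simp add: mult_smult_distrib[OF T rdiag_carrier]
          mult_smult_assoc_mat[OF mult_carrier_mat[OF T rdiag_carrier] adjoint_carrier[OF T]])
    then show ?thesis using \<Phi> hG by (simp add: positive_linear_map_def)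
  qed
  have add: "\<Phi> (G (\<lambda>j. f j + g j)) = \<Phi> (G f) + \<Phi> (G g)" for f g
  proof -
    have "rdiag d (\<lambda>j. f j + g j) = rdiag d f + rdiag d g"
      by (rule eq_matI) (auto simp: rdiag_def)
    then have "G (\<lambda>j. f j + g j) = G f + G g"
      unfolding G_def
      by (simp add: mult_add_distrib_mat[OF T rdiag_carrier rdiag_carrier]
          add_mult_distrib_mat[OF mult_carrier_mat[OF T rdiag_carrier] mult_carrier_mat[OF T rdiag_carrier]
            adjoint_carrier[OF T]])
    then show ?thesis using \<Phi> hG by (simp add: positive_linear_map_def)
  qed
  \<comment> \<open>Induction on the number \<open>m\<close> of diagonal entries switched on; the
    case 0 comes from homogeneity with factor 0, and at \<open>m = d\<close> the truncation is
    invisible to \<open>rdiag d\<close>.\<close>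
  have "sform (\<Phi> (G (\<lambda>j. if j < m then l j else 0))) u v
      = (\<Sum>i<m. complex_of_real (l i) * sform (\<Phi> (G (\<lambda>j. if j = i then 1 else 0))) u v)" for m
  proof (induction m)
    case 0
    have "\<Phi> (G (\<lambda>j. 0)) = 0 \<cdot>\<^sub>m \<Phi> (G (\<lambda>j. 0))" using smult[of 0 "\<lambda>j. 0"] by simp
    then have "sform (\<Phi> (G (\<lambda>j. 0))) u v = 0 * sform (\<Phi> (G (\<lambda>j. 0))) u v"
      using sform_smult_mat[OF hP u v, of 0] by metis
    then show ?case by simp
  next
    case (Suc m)
    have "(\<lambda>j. if j < Suc m then l j else 0)
        = (\<lambda>j. (if j < m then l j else 0) + l m * (if j = m then 1 else 0))"
      by (auto simp: less_Suc_eq)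
    then have "sform (\<Phi> (G (\<lambda>j. if j < Suc m then l j else 0))) u v
        = sform (\<Phi> (G (\<lambda>j. if j < m then l j else 0))) u v
          + complex_of_real (l m) * sform (\<Phi> (G (\<lambda>j. if j = m then 1 else 0))) u v"
      by (simp only: add smult sform_add_mat[OF hP smult_carrier_mat[OF hP] u v] sform_smult_mat[OF hP u v])
    then show ?case using Suc.IH by simp
  qed
  from this[of d] have "sform (\<Phi> (G (\<lambda>j. if j < d then l j else 0))) u v
      = (\<Sum>i<d. complex_of_real (l i) * sform (\<Phi> (G (\<lambda>j. if j = i then 1 else 0))) u v)" .
  moreover have "G (\<lambda>j. if j < d then l j else 0) = G l"
    unfolding G_def using rdiag_cong[of d "\<lambda>j. if j < d then l j else 0" l] by simp
  ultimately show ?thesis by (simp add: G_def)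
qed

text \<open>Let X be the sum of the \<open>R i\<close> and Y that of the \<open>l i\<close>
  multiples, simultaneously diagonalised by \<open>T\<close> and \<open>m\<close>. The inequality
  \<open>key\<close> below says that the sum of the \<open>R i / (s + l i)\<close> dominates X (s X
  + Y)^(-1) X in the quadratic form at \<open>v\<close>. It is proved by completing a
  square.\<close>

lemma resolvent_compression_le:
  fixes R :: "nat \<Rightarrow> complex mat"
  assumes R: "\<And>i. i < d \<Longrightarrow> psd k (R i)"
    and l: "\<And>i. i < d \<Longrightarrow> 0 < l i" and m: "\<And>j. j < k \<Longrightarrow> 0 < m j"
    and T: "T \<in> carrier_mat k k" "S \<in> carrier_mat k k" "T * S = 1\<^sub>m k"
    and X: "\<And>x y. x \<in> carrier_vec k \<Longrightarrow> y \<in> carrier_vec k \<Longrightarrow>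
      (\<Sum>i<d. sform (R i) x y) = sform (T * rdiag k (\<lambda>_. 1) * adjoint T) x y"
    and Y: "\<And>x y. x \<in> carrier_vec k \<Longrightarrow> y \<in> carrier_vec k \<Longrightarrow>
      (\<Sum>i<d. complex_of_real (l i) * sform (R i) x y) = sform (T * rdiag k m * adjoint T) x y"
    and s: "0 < s" and v: "v \<in> carrier_vec k"
  shows "(\<Sum>i<d. Re (sform (R i) v v) * (l i / (s + l i)))
    \<le> (\<Sum>j<k. (cmod ((adjoint T *\<^sub>v v) $ j))\<^sup>2 * (m j / (s + m j)))"
proof -
  define w where "w = adjoint T *\<^sub>v v"
  \<comment> \<open>The vector \<open>u\<close> solves (s X + Y) u = X v and so minimises the
    nonnegative sum used below. In the coordinates given by \<open>adjoint T\<close> this equation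
    is diagonal, with solution \<open>z\<close>.\<close>
  define z where "z = vec k (\<lambda>j. w $ j / complex_of_real (s + m j))"
  define u where "u = adjoint S *\<^sub>v z"
  have w: "w \<in> carrier_vec k" unfolding w_def by (rule mult_mat_vec_carrier[OF adjoint_carrier[OF T(1)] v])
  have z: "z \<in> carrier_vec k" by (simp add: z_def)
  have u: "u \<in> carrier_vec k" unfolding u_def by (rule mult_mat_vec_carrier[OF adjoint_carrier[OF T(2)] z])
  have "S * T = 1\<^sub>m k" by (rule mat_mult_left_right_inverse[OF T])
  then have "adjoint T * adjoint S = 1\<^sub>m k" using T(1,2) adjoint_mult[of S T] by simp
  then have Tu: "adjoint T *\<^sub>v u = z"
    unfolding u_def using assoc_mult_mat_vec[OF adjoint_carrier[OF T(1)] adjoint_carrier[OF T(2)] z] z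
    by simp
  define p where "p i = Re (sform (R i) v v)" for i
  define q where "q j = (cmod (w $ j))\<^sup>2" for j
  have Rc: "R i \<in> carrier_mat k k" if "i < d" for i
    using R[OF that] by (simp add: psd_def hermitian_def)
  have sX: "(\<Sum>i<d. sform (R i) x y)
      = (\<Sum>j<k. cnj ((adjoint T *\<^sub>v x) $ j) * (adjoint T *\<^sub>v y) $ j)"
    if x: "x \<in> carrier_vec k" and y: "y \<in> carrier_vec k" for x y
    unfolding X[OF x y] sform_congruence[OF T(1) rdiag_carrier x y]
      sform_rdiag[OF mult_mat_vec_carrier[OF adjoint_carrier[OF T(1)] x]
        mult_mat_vec_carrier[OF adjoint_carrier[OF T(1)] y]]
    by simp
  have sm: "0 < s + m j" if "j < k" for j using s m[OF that] by simp
  have sl: "0 < s + l i" if "i < d" for i using s l[OF that] by simp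
  have pq: "(\<Sum>i<d. p i) = (\<Sum>j<k. q j)"
  proof -
    have "(\<Sum>i<d. p i) = Re (\<Sum>i<d. sform (R i) v v)" by (simp add: p_def)
    also have "\<dots> = (\<Sum>j<k. q j)"
      unfolding sX[OF v v] q_def cmod_power2 w_def by (simp add: power2_eq_square)
    finally show ?thesis .
  qed
  \<comment> \<open>At the minimiser both cross sums and the quadratic sum have this same value, as
    \<open>vu\<close> and \<open>uu\<close> confirm; two copies with a minus sign and one with a
    plus leave a single negative copy.\<close>
  have uv: "(\<Sum>i<d. Re (sform (R i) u v)) = (\<Sum>j<k. q j / (s + m j))"
  proof -
    have "(\<Sum>i<d. Re (sform (R i) u v)) = Re (\<Sum>i<d. sform (R i) u v)" by simp
    also have "\<dots> = (\<Sum>j<k. Re (cnj (z $ j) * w $ j))"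
      unfolding sX[OF u v] Tu w_def by simp
    also have "\<dots> = (\<Sum>j<k. q j / (s + m j))"
    proof (rule sum.cong[OF refl])
      fix j assume "j \<in> {..<k}"
      then have "cnj (z $ j) * w $ j = (w $ j * cnj (w $ j)) / complex_of_real (s + m j)"
        by (simp add: z_def)
      also have "\<dots> = complex_of_real (q j / (s + m j))"
        unfolding q_def complex_norm_square[symmetric] by simp
      finally show "Re (cnj (z $ j) * w $ j) = q j / (s + m j)" by simp
    qed
    finally show ?thesis .
  qed
  have vu: "(\<Sum>i<d. Re (sform (R i) v u)) = (\<Sum>j<k. q j / (s + m j))"
  proof -
    have "Re (sform (R i) v u) = Re (sform (R i) u v)" if "i < d" for i
      using arg_cong[OF sform_cnj[OF Rc[OF that] u v], of Re] R[OF that]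
      by (simp add: psd_def hermitian_def)
    then show ?thesis using uv by simp
  qed
  have uu: "(\<Sum>i<d. (s + l i) * Re (sform (R i) u u)) = (\<Sum>j<k. q j / (s + m j))"
  proof -
    have "(\<Sum>i<d. (s + l i) * Re (sform (R i) u u))
        = s * Re (\<Sum>i<d. sform (R i) u u) + Re (\<Sum>i<d. complex_of_real (l i) * sform (R i) u u)"
      by (simp add: distrib_right sum.distrib sum_distrib_left)
    also have "\<dots> = (\<Sum>j<k. (s + m j) * (cmod (z $ j))\<^sup>2)"
      unfolding X[OF u u] Y[OF u u] sform_congruence[OF T(1) rdiag_carrier u u] Tu Re_sform_rdiag[OF z]
      by (simp add: distrib_right sum.distrib sum_distrib_left)
    also have "\<dots> = (\<Sum>j<k. q j / (s + m j))"
    proof (rule sum.cong[OF refl])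
      fix j assume "j \<in> {..<k}"
      then have j: "j < k" by simp
      have "(cmod (z $ j))\<^sup>2 = q j / (s + m j)\<^sup>2"
        using sm[OF j] j by (simp add: z_def q_def norm_divide power_divide del: of_real_add)
      then show "(s + m j) * (cmod (z $ j))\<^sup>2 = q j / (s + m j)"
        using sm[OF j] by (simp add: power2_eq_square)
    qed
    finally show ?thesis .
  qed
  \<comment> \<open>Each \<open>R i\<close> is evaluated at its own vector. Division by
    \<open>s + l i\<close> frees the cross terms of \<open>l i\<close> and makes the quadratic terms
    linear in it, so that they sum to forms of X and Y.\<close>
  have "0 \<le> (\<Sum>i<d. Re (sform (R i) (v - complex_of_real (s + l i) \<cdot>\<^sub>v u)
      (v - complex_of_real (s + l i) \<cdot>\<^sub>v u)) / (s + l i))"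
  proof (intro sum_nonneg divide_nonneg_pos)
    fix i assume "i \<in> {..<d}"
    then have i: "i < d" by simp
    show "0 < s + l i" by (rule sl[OF i])
    have "v - complex_of_real (s + l i) \<cdot>\<^sub>v u \<in> carrier_vec k" using u v by simp
    then show "0 \<le> Re (sform (R i) (v - complex_of_real (s + l i) \<cdot>\<^sub>v u) (v - complex_of_real (s + l i) \<cdot>\<^sub>v u))"
      using R[OF i] by (simp add: psd_def qform_eq_sform)
  qed
  also have "\<dots> = (\<Sum>i<d. p i / (s + l i) - (Re (sform (R i) u v) + Re (sform (R i) v u))
      + (s + l i) * Re (sform (R i) u u))"
  proof (rule sum.cong[OF refl])
    fix i assume "i \<in> {..<d}"
    then have i: "i < d" by simp
    have "Re (sform (R i) (v - complex_of_real (s + l i) \<cdot>\<^sub>v u) (v - complex_of_real (s + l i) \<cdot>\<^sub>v u))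
        = p i - (s + l i) * (Re (sform (R i) u v) + Re (sform (R i) v u)) + (s + l i)\<^sup>2 * Re (sform (R i) u u)"
      unfolding sform_diff_smult[OF Rc[OF i] u v] p_def
      by (simp only: plus_complex.sel minus_complex.sel Re_complex_of_real Im_complex_of_real
          times_complex.sel mult_zero_left diff_zero)
    then show "Re (sform (R i) (v - complex_of_real (s + l i) \<cdot>\<^sub>v u)
          (v - complex_of_real (s + l i) \<cdot>\<^sub>v u)) / (s + l i)
        = p i / (s + l i) - (Re (sform (R i) u v) + Re (sform (R i) v u)) + (s + l i) * Re (sform (R i) u u)"
      using sl[OF i] by (simp add: add_divide_distrib diff_divide_distrib power2_eq_square)
  qed
  also have "\<dots> = (\<Sum>i<d. p i / (s + l i)) - (\<Sum>j<k. q j / (s + m j))"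
    using uv vu uu by (simp add: sum.distrib sum_subtractf)
  finally have key: "(\<Sum>j<k. q j / (s + m j)) \<le> (\<Sum>i<d. p i / (s + l i))" by simp
  \<comment> \<open>Writing x / (s + x) as 1 - s / (s + x) reverses the direction of
    \<open>key\<close>; the constant parts agree by \<open>pq\<close>.\<close>
  have frac: "a * (b / (s + b)) = a - s * (a / (s + b))" if "0 < s + b" for a b :: real
  proof -
    have "a - s * (a / (s + b)) = (a * (s + b) - s * a) / (s + b)"
      using that by (simp add: diff_divide_distrib)
    then show ?thesis by (simp add: distrib_left mult.commute)
  qed
  have "(\<Sum>i<d. p i * (l i / (s + l i))) = (\<Sum>i<d. p i - s * (p i / (s + l i)))"
    using sl frac by (intro sum.cong refl) auto
  also have "\<dots> = (\<Sum>j<k. q j) - s * (\<Sum>i<d. p i / (s + l i))"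
    by (simp add: sum_subtractf sum_distrib_left pq)
  also have "\<dots> \<le> (\<Sum>j<k. q j) - s * (\<Sum>j<k. q j / (s + m j))"
    using key s by (simp add: mult_left_mono)
  also have "\<dots> = (\<Sum>j<k. q j - s * (q j / (s + m j)))"
    by (simp add: sum_subtractf sum_distrib_left)
  also have "\<dots> = (\<Sum>j<k. q j * (m j / (s + m j)))"
    using sm frac by (intro sum.cong refl) auto
  finally show ?thesis by (simp add: p_def q_def w_def)
qed

lemma hermitian_minus:
  assumes "hermitian n A" "hermitian n B"
  shows "hermitian n (A - B)"
proof -
  have A: "A \<in> carrier_mat n n" "adjoint A = A" and B: "B \<in> carrier_mat n n" "adjoint B = B"
    using assms by (auto simp: hermitian_def)
  have "adjoint (A - B) = adjoint A - adjoint B"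
    using A(1) B(1) by (intro eq_matI) (auto simp: adjoint_index)
  then show ?thesis using A B by (simp add: hermitian_def minus_carrier_mat)
qed

text \<open>At a vector \<open>v\<close> the two quadratic forms are sums of
  \<open>p i * l i powr t\<close> and of \<open>q j * m j powr t\<close>, so the matrix inequality
  reduces to a scalar one, supplied by the resolvent comparison for all \<open>s > 0\<close>.
  Positive definiteness of the mean is recorded as well because \<open>loewner_mono\<close> compares
  positive definite matrices.\<close>

theorem positive_linear_map_gmean_le:
  assumes \<Phi>: "positive_linear_map d k \<Phi>" and pdm: "\<forall>A. pd d A \<longrightarrow> pd k (\<Phi> A)"
    and T: "T \<in> carrier_mat d d" "S \<in> carrier_mat d d" "T * S = 1\<^sub>m d"
    and l: "\<forall>i<d. 0 < l i" and t: "0 \<le> t" "t \<le> 1"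
  shows "loewner_le k (\<Phi> (T * rdiag d (\<lambda>i. l i powr t) * adjoint T))
      (gmean k (\<Phi> (T * rdiag d (\<lambda>_. 1) * adjoint T)) (\<Phi> (T * rdiag d l * adjoint T)) t)"
    and "pd k (gmean k (\<Phi> (T * rdiag d (\<lambda>_. 1) * adjoint T)) (\<Phi> (T * rdiag d l * adjoint T)) t)"
proof -
  define X where "X = \<Phi> (T * rdiag d (\<lambda>_. 1) * adjoint T)"
  define Y where "Y = \<Phi> (T * rdiag d l * adjoint T)"
  define Z where "Z = \<Phi> (T * rdiag d (\<lambda>i. l i powr t) * adjoint T)"
  define R where "R i = \<Phi> (T * rdiag d (\<lambda>j. if j = i then 1 else 0) * adjoint T)" for i
  have pdX: "pd k X" and pdY: "pd k Y"
    unfolding X_def Y_def using pdm pd_congruence[OF T pd_rdiag] l by auto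
  have psdR: "psd k (R i)" for i
    unfolding R_def using \<Phi> psd_congruence_rdiag[OF T(1), of "\<lambda>j. if j = i then 1 else 0"]
    by (auto simp: positive_linear_map_def)
  have hZ: "hermitian k Z"
    unfolding Z_def using \<Phi> hermitian_congruence[OF T(1) hermitian_rdiag]
    by (auto simp: positive_linear_map_def)
  obtain P Q m where P: "P \<in> carrier_mat k k" "Q \<in> carrier_mat k k" "P * Q = 1\<^sub>m k"
    and m: "\<forall>j<k. 0 < m j"
    and XP: "X = P * rdiag k (\<lambda>_. 1) * adjoint P" and YP: "Y = P * rdiag k m * adjoint P"
    and XY: "\<And>t. gmean k X Y t = P * rdiag k (\<lambda>j. m j powr t) * adjoint P"
    using gmean_simultaneous_diagonalization[OF pdX pdY] by blast
  have m': "\<forall>j<k. 0 < m j powr t" using m by auto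
  show pdG: "pd k (gmean k X Y t)"
    unfolding XY by (rule pd_congruence[OF P pd_rdiag[OF m']])
  have sX: "(\<Sum>i<d. sform (R i) x y) = sform X x y"
    and sY: "(\<Sum>i<d. complex_of_real (l i) * sform (R i) x y) = sform Y x y"
    and sZ: "(\<Sum>i<d. complex_of_real (l i powr t) * sform (R i) x y) = sform Z x y"
    if "x \<in> carrier_vec k" "y \<in> carrier_vec k" for x y
    using positive_linear_map_sform[OF \<Phi> T(1) that, of "\<lambda>_. 1"]
      positive_linear_map_sform[OF \<Phi> T(1) that, of l]
      positive_linear_map_sform[OF \<Phi> T(1) that, of "\<lambda>i. l i powr t"]
    by (simp_all only: X_def Y_def Z_def R_def of_real_1 mult_1)
  have "0 \<le> Re (qform (gmean k X Y t - Z) v)" if v: "v \<in> carrier_vec k" for v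
  proof -
    define p where "p i = Re (sform (R i) v v)" for i
    define q where "q j = (cmod ((adjoint P *\<^sub>v v) $ j))\<^sup>2" for j
    have w: "adjoint P *\<^sub>v v \<in> carrier_vec k" by (rule mult_mat_vec_carrier[OF adjoint_carrier[OF P(1)] v])
    have Pq: "Re (sform (P * rdiag k f * adjoint P) v v) = (\<Sum>j<k. q j * f j)" for f
      unfolding sform_congruence[OF P(1) rdiag_carrier v v] Re_sform_rdiag[OF w] q_def
      by (simp add: mult.commute)
    have "(\<Sum>i<d. p i * l i powr t) \<le> (\<Sum>j<k. q j * m j powr t)"
    proof -
      \<comment> \<open>The integral defining the constant diverges at both endpoints. There the
        claim is an equality between two expansions of the form of \<open>X\<close> for
        \<open>t = 0\<close> and of \<open>Y\<close> for \<open>t = 1\<close>.\<close>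
      consider "t = 0" | "t = 1" | "0 < t" "t < 1" using t by linarith
      then show ?thesis
      proof cases
        case 1
        have "(\<Sum>i<d. p i) = (\<Sum>j<k. q j)"
          using arg_cong[OF sX[OF v v], of Re] Pq[of "\<lambda>_. 1"] by (simp add: p_def XP)
        moreover have "(\<Sum>i<d. p i * l i powr t) = (\<Sum>i<d. p i)"
          using l 1 by (intro sum.cong) auto
        moreover have "(\<Sum>j<k. q j * m j powr t) = (\<Sum>j<k. q j)"
          using m 1 by (intro sum.cong) auto
        ultimately show ?thesis by simp
      next
        case 2
        have "(\<Sum>i<d. p i * l i) = (\<Sum>j<k. q j * m j)"
          using arg_cong[OF sY[OF v v], of Re] Pq[of m] by (simp add: p_def YP mult.commute)
        moreover have "(\<Sum>i<d. p i * l i powr t) = (\<Sum>i<d. p i * l i)"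
          using l 2 by (intro sum.cong) auto
        moreover have "(\<Sum>j<k. q j * m j powr t) = (\<Sum>j<k. q j * m j)"
          using m 2 by (intro sum.cong) auto
        ultimately show ?thesis by simp
      next
        case 3
        show ?thesis
        proof (rule sum_powr_le_of_resolvent_le[OF _ _ 3])
          show "0 \<le> p i" for i
            using psdR[of i] v by (simp add: p_def psd_def qform_eq_sform)
          show "(\<Sum>i<d. p i * (l i / (s + l i))) \<le> (\<Sum>j<k. q j * (m j / (s + m j)))" if s: "0 < s" for s
            unfolding p_def q_def
            by (rule resolvent_compression_le[OF psdR _ _ P _ _ s v])
              (use l m sX sY in \<open>simp_all add: XP YP\<close>)
        qed (use l m in \<open>auto simp: q_def\<close>)
      qed
    qed
    moreover have "(\<Sum>i<d. p i * l i powr t) = Re (sform Z v v)"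
      using arg_cong[OF sZ[OF v v], of Re] by (simp add: p_def mult.commute)
    moreover have "Re (qform (gmean k X Y t - Z) v) = Re (sform (gmean k X Y t) v v) - Re (sform Z v v)"
      using hZ pd_carrier[OF pdG] v by (simp add: qform_eq_sform sform_minus_mat hermitian_def)
    ultimately show ?thesis using Pq[of "\<lambda>j. m j powr t"] by (simp add: XY)
  qed
  then show "loewner_le k Z (gmean k X Y t)"
    using hZ pdG hermitian_minus[OF _ hZ] by (auto simp: loewner_le_def psd_def pd_def)
qed

section \<open>Geodesic convexity of the composition\<close>

text \<open>Monotonicity of \<open>h\<close> is applied to Ando's inequality, then convexity of
  \<open>h\<close> to the geodesic between the images. The form with an arbitrary invertible
  \<open>T\<close> and positive \<open>l\<close> serves both a geodesic and its pointwise
  inverse.\<close>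

lemma geodesic_inequality_compose:
  assumes mono: "loewner_mono k h" and conv: "geodesically_convex k h"
    and \<Phi>: "positive_linear_map d k \<Phi>" and pdm: "\<forall>A. pd d A \<longrightarrow> pd k (\<Phi> A)"
    and T: "T \<in> carrier_mat d d" "S \<in> carrier_mat d d" "T * S = 1\<^sub>m d"
    and l: "\<forall>i<d. 0 < l i" and t: "0 \<le> t" "t \<le> 1"
  shows "h (\<Phi> (T * rdiag d (\<lambda>i. l i powr t) * adjoint T))
    \<le> (1 - t) * h (\<Phi> (T * rdiag d (\<lambda>_. 1) * adjoint T)) + t * h (\<Phi> (T * rdiag d l * adjoint T))"
proof -
  have pd: "pd k (\<Phi> (T * rdiag d f * adjoint T))" if "\<forall>i<d. 0 < f i" for f
    using pdm pd_congruence[OF T pd_rdiag[OF that]] by blast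
  have lt: "\<forall>i<d. 0 < l i powr t" using l by auto
  have "h (\<Phi> (T * rdiag d (\<lambda>i. l i powr t) * adjoint T))
      \<le> h (gmean k (\<Phi> (T * rdiag d (\<lambda>_. 1) * adjoint T)) (\<Phi> (T * rdiag d l * adjoint T)) t)"
    using mono positive_linear_map_gmean_le[OF \<Phi> pdm T l t] pd[OF lt]
    by (auto simp: loewner_mono_def)
  also have "\<dots> \<le> (1 - t) * h (\<Phi> (T * rdiag d (\<lambda>_. 1) * adjoint T)) + t * h (\<Phi> (T * rdiag d l * adjoint T))"
    using conv pd[of "\<lambda>_. 1"] pd[OF l] t by (auto simp: geodesically_convex_def)
  finally show ?thesis .
qed

theorem theorem11:
  fixes d k :: nat and h :: "complex mat \<Rightarrow> real" and \<Phi> :: "complex mat \<Rightarrow> complex mat"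
    and r :: real
  assumes "loewner_mono k h"
    and "geodesically_convex k h"
    and "r \<in> {1, -1}"
    and "positive_linear_map d k \<Phi>"
    and "\<forall>A. pd d A \<longrightarrow> pd k (\<Phi> A)"
  shows "geodesically_convex d (\<lambda>S. h (\<Phi> (mpow d S r)))"
  unfolding geodesically_convex_def
proof (intro allI impI)
  fix A B :: "complex mat" and t :: real
  assume pd: "pd d A" "pd d B" and t: "0 \<le> t" "t \<le> 1"
  obtain T S l where T: "T \<in> carrier_mat d d" "S \<in> carrier_mat d d" "T * S = 1\<^sub>m d"
    and l: "\<forall>i<d. 0 < l i"
    and A: "A = T * rdiag d (\<lambda>_. 1) * adjoint T" and B: "B = T * rdiag d l * adjoint T"
    and G: "\<And>t. gmean d A B t = T * rdiag d (\<lambda>i. l i powr t) * adjoint T"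
    using gmean_simultaneous_diagonalization[OF pd] by blast
  note compose = geodesic_inequality_compose[OF assms(1,2,4,5) _ _ _ _ t]
  have lt: "\<forall>i<d. 0 < l i powr t" using l by auto
  consider "r = 1" | "r = -1" using assms(3) by auto
  then show "h (\<Phi> (mpow d (gmean d A B t) r)) \<le> (1 - t) * h (\<Phi> (mpow d A r)) + t * h (\<Phi> (mpow d B r))"
  proof cases
    case 1
    have "pd d (gmean d A B t)" unfolding G by (rule pd_congruence[OF T pd_rdiag[OF lt]])
    then show ?thesis
      using compose[OF T l] pd by (simp add: 1 mpow_one G flip: A B)
  next
    case 2
    \<comment> \<open>Inversion yields the geodesic with \<open>adjoint S\<close> in the role of
      \<open>T\<close>, \<open>adjoint T\<close> in that of its inverse, and the reciprocals
      \<open>1 / l i\<close>; taking reciprocals commutes with the power \<open>t\<close>, so the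
      parameter is unchanged.\<close>
    have TS: "adjoint S * adjoint T = 1\<^sub>m d" using T adjoint_mult[of T S] by simp
    have l': "\<forall>i<d. 0 < 1 / l i" using l by simp
    have "rdiag d (\<lambda>i. 1 / l i powr t) = rdiag d (\<lambda>i. (1 / l i) powr t)"
      using l by (intro rdiag_cong) (auto simp: powr_divide)
    then have G': "mpow d (gmean d A B t) r
        = adjoint S * rdiag d (\<lambda>i. (1 / l i) powr t) * adjoint (adjoint S)"
      unfolding G 2 using mpow_minus_one_congruence[OF T lt] by simp
    have A': "mpow d A r = adjoint S * rdiag d (\<lambda>_. 1) * adjoint (adjoint S)"
      unfolding A 2 using mpow_minus_one_congruence[OF T, of "\<lambda>_. 1"] by simp
    have B': "mpow d B r = adjoint S * rdiag d (\<lambda>i. 1 / l i) * adjoint (adjoint S)"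
      unfolding B 2 by (rule mpow_minus_one_congruence[OF T l])
    show ?thesis
      unfolding G' A' B' by (rule compose[OF adjoint_carrier[OF T(2)] adjoint_carrier[OF T(1)] TS l'])
  qed
qed

end
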